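(* Let $f\in\mathbb{C}[h]$. The generalized Heisenberg algebra $\mathcal{H}(f)$ is isomorphic, as a $\mathbb{C}$-algebra, to a generalized down-up algebra (that is, to $L(g,r,s,\gamma)$ for some $g\in\mathbb{C}[H]$ and $r,s,\gamma\in\mathbb{C}$) if and only if $\deg f\leq 1$.
   Context: For a polynomial $f\in\mathbb{C}[h]$, the generalized Heisenberg algebra $\mathcal{H}(f)$ is the unital associative $\mathbb{C}$-algebra with generators $x,y,h$ and defining relations $$hx=xf(h),\qquad yh=f(h)y,\qquad yx-xy=f(h)-h.$$ Here $\deg f$ is the degree of $f$ as a polynomial in $h$; constant polynomials (including the zero polynomial) are regarded as having degree $0$. For $g\in\mathbb{C}[H]$ and $r,s,\gamma\in\mathbb{C}$, the generalized down-up algebra $L(g,r,s,\gamma)$ is the unital associative $\mathbb{C}$-algebra generated by $d,u,H$ subject to the relations $$dH-rHd+\gamma d=0,\qquad Hu-ruH+\gamma u=0,\qquad du-sud+g(H)=0.$$ *)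

theory Defs
  imports
    Complex_Main
    "HOL-Library.Poly_Mapping"
    "HOL-Computational_Algebra.Polynomial"
    "HOL-Algebra.QuotRing"
    "HOL-Algebra.Module"
begin

section \<open>Free algebras\<close>

text \<open>
  The convolution product on \<open>'w \<Rightarrow>\<^sub>0 complex\<close> is built from the \<open>+\<close> of an arbitrary, not
  necessarily commutative, monoid \<open>'w\<close>.  Words under concatenation, written \<open>+\<close>, therefore give
  the free associative algebra.  Words are wrapped in their own type so that no arithmetic
  instance is imposed on \<open>list\<close>.
\<close>

datatype 'a word = Word "'a list"

instantiation word :: (type) monoid_add
begin

definition zero_word :: "'a word" where
  "0 = Word []"

fun plus_word :: "'a word \<Rightarrow> 'a word \<Rightarrow> 'a word" where
  "Word u + Word v = Word (u @ v)"

instance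
proof
  fix a b c :: "'a word"
  show "a + b + c = a + (b + c)" by (cases a; cases b; cases c) simp
  show "0 + a = a" by (cases a) (simp add: zero_word_def)
  show "a + 0 = a" by (cases a) (simp add: zero_word_def)
qed

end

type_synonym 'g free_alg = "'g word \<Rightarrow>\<^sub>0 complex"

definition scalar :: "complex \<Rightarrow> 'g free_alg" where
  "scalar c = Poly_Mapping.single 0 c"

definition gen :: "'g \<Rightarrow> 'g free_alg" where
  "gen a = Poly_Mapping.single (Word [a]) 1"

text \<open>The library's \<^const>\<open>poly\<close> evaluates in commutative rings only.\<close>

definition poly_at :: "complex poly \<Rightarrow> 'g free_alg \<Rightarrow> 'g free_alg" where
  "poly_at f a = (\<Sum>i\<le>Polynomial.degree f. scalar (Polynomial.coeff f i) * a ^ i)"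

text \<open>
  Complex algebras are \<^typ>\<open>(complex, 'b) module\<close> records, i.e. ring records with a scalar
  multiplication.  (The locale \<^locale>\<open>algebra\<close> of the library is about commutative algebras
  and so does not apply here.)
\<close>

definition free_algebra :: "(complex, 'g free_alg) module" where
  "free_algebra =
     \<lparr>carrier = UNIV, mult = (*), one = 1, zero = 0, add = (+), smult = (\<lambda>c p. scalar c * p)\<rparr>"

lemma ring_free_algebra: "ring (free_algebra :: (complex, 'g free_alg) module)"
proof (rule ringI)
  show "abelian_group (free_algebra :: (complex, 'g free_alg) module)"
    by (rule abelian_groupI)
      (auto simp: free_algebra_def add.assoc add.commute intro: exI[of _ "- x" for x] left_minus)
  show "Group.monoid (free_algebra :: (complex, 'g free_alg) module)"
    by (rule monoidI) (auto simp: free_algebra_def mult.assoc)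
qed (auto simp: free_algebra_def distrib_left distrib_right)


section \<open>Algebras given by generators and relations\<close>

text \<open>
  A relation \<open>p = 0\<close> is represented by \<open>p\<close>.  In HOL-Algebra, ideals of noncommutative rings are
  two-sided, hence so is the generated ideal.
\<close>

definition relation_ideal :: "'g free_alg set \<Rightarrow> 'g free_alg set" where
  "relation_ideal rels = Idl\<^bsub>free_algebra\<^esub> rels"

text \<open>
  The scalar multiplication on cosets follows the pattern of \<^const>\<open>rcoset_mult\<close>; see
  \<open>presented_algebra_smult\<close> below.
\<close>

definition presented_algebra :: "'g free_alg set \<Rightarrow> (complex, 'g free_alg set) module" where
  "presented_algebra rels =
     ring.extend (free_algebra Quot relation_ideal rels)
       \<lparr>smult = (\<lambda>c X. \<Union>p\<in>X. relation_ideal rels +>\<^bsub>free_algebra\<^esub> (c \<odot>\<^bsub>free_algebra\<^esub> p))\<rparr>"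

lemma ideal_relation_ideal: "ideal (relation_ideal rels) free_algebra"
  unfolding relation_ideal_def
  by (rule ring.genideal_ideal[OF ring_free_algebra]) (simp add: free_algebra_def)

lemma ring_presented_algebra: "ring (presented_algebra rels)"
proof -
  define Q where "Q = free_algebra Quot relation_ideal rels"
  interpret Q: ring Q
    unfolding Q_def by (rule ideal.quotient_is_ring[OF ideal_relation_ideal])
  have [simp]:
    "carrier (presented_algebra rels) = carrier Q"
    "\<zero>\<^bsub>presented_algebra rels\<^esub> = \<zero>\<^bsub>Q\<^esub>" "\<one>\<^bsub>presented_algebra rels\<^esub> = \<one>\<^bsub>Q\<^esub>"
    "x \<oplus>\<^bsub>presented_algebra rels\<^esub> y = x \<oplus>\<^bsub>Q\<^esub> y"
    "x \<otimes>\<^bsub>presented_algebra rels\<^esub> y = x \<otimes>\<^bsub>Q\<^esub> y" for x y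
    by (simp_all add: presented_algebra_def Q_def ring.defs)
  show ?thesis
  proof (rule ringI)
    show "abelian_group (presented_algebra rels)"
      by (rule abelian_groupI) (auto simp: Q.a_ac intro: Q.a_inv_closed Q.l_neg)
    show "Group.monoid (presented_algebra rels)"
      by (rule monoidI) (auto simp: Q.m_assoc)
  qed (auto simp: Q.l_distr Q.r_distr)
qed

lemma presented_algebra_smult:
  "c \<odot>\<^bsub>presented_algebra rels\<^esub> (relation_ideal rels +>\<^bsub>free_algebra\<^esub> p) =
     relation_ideal rels +>\<^bsub>free_algebra\<^esub> (scalar c * p)"
proof -
  interpret I: ideal "relation_ideal rels" free_algebra
    by (rule ideal_relation_ideal)
  have smult: "c \<odot>\<^bsub>free_algebra\<^esub> q = scalar c * q" for q
    by (simp add: free_algebra_def)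
  have coset: "relation_ideal rels +>\<^bsub>free_algebra\<^esub> q = {i + q | i. i \<in> relation_ideal rels}" for q
    by (auto simp: a_r_coset_def' free_algebra_def)
  have eq: "relation_ideal rels +>\<^bsub>free_algebra\<^esub> (scalar c * q) =
          relation_ideal rels +>\<^bsub>free_algebra\<^esub> (scalar c * p)"
    if "q \<in> relation_ideal rels +>\<^bsub>free_algebra\<^esub> p" for q
  proof -
    from that obtain i where i: "i \<in> relation_ideal rels" and q: "q = i + p"
      by (auto simp: coset)
    have carrier: "scalar c * p \<in> carrier free_algebra"
      by (simp add: free_algebra_def)
    have "scalar c * i \<in> relation_ideal rels"
      using I.I_l_closed[OF i, of "scalar c"] by (simp add: free_algebra_def)
    then have "scalar c * q \<in> relation_ideal rels +>\<^bsub>free_algebra\<^esub> (scalar c * p)"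
      by (auto simp: coset q distrib_left)
    then show ?thesis
      by (rule I.a_repr_independence[symmetric, OF _ carrier I.a_subgroup])
  qed
  have self: "p \<in> relation_ideal rels +>\<^bsub>free_algebra\<^esub> p"
    using I.a_rcos_self[of p] by (simp add: free_algebra_def)
  have "c \<odot>\<^bsub>presented_algebra rels\<^esub> (relation_ideal rels +>\<^bsub>free_algebra\<^esub> p) =
          (\<Union>q\<in>relation_ideal rels +>\<^bsub>free_algebra\<^esub> p.
             relation_ideal rels +>\<^bsub>free_algebra\<^esub> (scalar c * q))"
    by (simp add: presented_algebra_def ring.defs smult)
  also have "\<dots> = relation_ideal rels +>\<^bsub>free_algebra\<^esub> (scalar c * p)"
    using eq self by blast
  finally show ?thesis .
qed

definition algebra_iso ::
    "(complex, 'a) module \<Rightarrow> (complex, 'b) module \<Rightarrow> ('a \<Rightarrow> 'b) set" where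
  "algebra_iso A B =
     {\<phi> \<in> ring_iso A B. \<forall>c. \<forall>x\<in>carrier A. \<phi> (c \<odot>\<^bsub>A\<^esub> x) = c \<odot>\<^bsub>B\<^esub> \<phi> x}"

definition algebra_isomorphic :: "(complex, 'a) module \<Rightarrow> (complex, 'b) module \<Rightarrow> bool"
    (infix \<open>\<cong>\<^sub>a\<^sub>l\<^sub>g\<close> 50) where
  "A \<cong>\<^sub>a\<^sub>l\<^sub>g B \<longleftrightarrow> algebra_iso A B \<noteq> {}"


section \<open>Generalized Heisenberg algebras and generalized down-up algebras\<close>

datatype heisenberg_gen = Gx | Gy | Gh

definition generalized_heisenberg ::
    "complex poly \<Rightarrow> (complex, heisenberg_gen free_alg set) module" where
  "generalized_heisenberg f =
     (let x = gen Gx; y = gen Gy; h = gen Gh in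
      presented_algebra
        {h * x - x * poly_at f h,
         y * h - poly_at f h * y,
         (y * x - x * y) - (poly_at f h - h)})"

datatype down_up_gen = Gd | Gu | GH

definition generalized_down_up ::
    "complex poly \<Rightarrow> complex \<Rightarrow> complex \<Rightarrow> complex \<Rightarrow> (complex, down_up_gen free_alg set) module"
  where
  "generalized_down_up g r s \<gamma> =
     (let d = gen Gd; u = gen Gu; H = gen GH in
      presented_algebra
        {d * H - scalar r * H * d + scalar \<gamma> * d,
         H * u - scalar r * u * H + scalar \<gamma> * u,
         d * u - scalar s * u * d + poly_at g H})"

end

theory Submission
  imports
    Defs
    "HOL-Library.Function_Algebras"
    "HOL-Real_Asymp.Real_Asymp"
begin

text \<open>
  If \<open>f = a h + b\<close>, then renaming \<open>x, y, h\<close> to \<open>u, d, H\<close> turns the relations of \<open>\<H>(f)\<close> into those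
  of \<open>L(H - f, a, 1, -b)\<close>.

  If \<open>deg f \<ge> 2\<close>, the two families differ in growth.  Every \<open>L(g, r, s, \<gamma>)\<close>, also for
  \<open>r s = 0\<close>, is spanned by the monomials \<open>u\<^sup>i H\<^sup>j d\<^sup>k\<close> and has polynomial growth.  In \<open>\<H>(f)\<close>, moving
  \<open>h\<close> past \<open>x\<close> composes with \<open>f\<close>, so the \<open>2\<^sup>n\<close> words \<open>h\<^sup>e\<^sup>1 x h\<^sup>e\<^sup>2 x \<cdots> h\<^sup>e\<^sup>n x\<close> with
  \<open>e\<^sub>i \<in> {0, 1}\<close> equal \<open>x\<^sup>n\<close> times polynomials in \<open>h\<close> whose degrees are pairwise distinct, being
  determined by the base \<open>deg f\<close> digits \<open>e\<^sub>i\<close>; these words are linearly independent.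
\<close>

section \<open>Homomorphisms out of the free algebra\<close>

lemma scalar_0 [simp]: "scalar 0 = 0"
  by (simp add: scalar_def)

lemma scalar_1 [simp]: "scalar 1 = 1"
  by (simp add: scalar_def)

lemma scalar_add: "scalar (a + b) = scalar a + scalar b"
  by (simp add: scalar_def single_add)

lemma scalar_mult: "scalar (a * b) = scalar a * scalar b"
  by (simp add: scalar_def mult_single)

lemma scalar_uminus: "scalar (- a) = - scalar a"
  by (simp add: scalar_def single_uminus)

lemma scalar_diff: "scalar (a - b) = scalar a - scalar b"
  by (simp add: scalar_def single_diff)

lemma single_eq_scalar_mult: "Poly_Mapping.single w c = scalar c * Poly_Mapping.single w 1"
  by (simp add: scalar_def mult_single)

lemma single_Word_Cons:
  "Poly_Mapping.single (Word (a # ws)) 1 = gen a * Poly_Mapping.single (Word ws) 1"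
  by (simp add: gen_def mult_single)

text \<open>Updating at a key outside the support is the same as adding a
  \<open>single\<close>.\<close>

lemma poly_mapping_add_induct [case_names single add]:
  fixes p :: "'a \<Rightarrow>\<^sub>0 'b::comm_monoid_add"
  assumes single: "\<And>w c. P (Poly_Mapping.single w c)"
    and add: "\<And>p q. P p \<Longrightarrow> P q \<Longrightarrow> P (p + q)"
  shows "P p"
proof (induction p rule: update_induct)
  case const
  show ?case using single[of undefined 0] by simp
next
  case (update p w c)
  have "Poly_Mapping.update w c p = p + Poly_Mapping.single w c"
    using update.hyps(1)
    by (intro poly_mapping_eqI) (auto simp: lookup_update lookup_add lookup_single in_keys_iff when_def)
  then show ?case using add[OF update.IH single] by simp
qed

text \<open>Every element is a sum of scalar multiples of words, and a nonempty word is a product of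
  generators.\<close>

lemma free_alg_induct [case_names scalar gen add mult]:
  fixes p :: "'g free_alg"
  assumes scalar: "\<And>c. P (scalar c)" and gen: "\<And>a. P (gen a)"
    and add: "\<And>p q. P p \<Longrightarrow> P q \<Longrightarrow> P (p + q)" and mult: "\<And>p q. P p \<Longrightarrow> P q \<Longrightarrow> P (p * q)"
  shows "P p"
proof (induction p rule: poly_mapping_add_induct)
  case (single w c)
  obtain ws where w: "w = Word ws" by (cases w)
  have "P (Poly_Mapping.single (Word ws) 1)"
  proof (induction ws)
    case Nil
    show ?case using scalar[of 1] by (simp add: scalar_def zero_word_def)
  next
    case (Cons a ws)
    then show ?case using mult[OF gen] by (simp add: single_Word_Cons)
  qed
  then show ?case
    using mult[OF scalar] by (subst single_eq_scalar_mult) (simp add: w)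
qed (rule add)

lemma scalar_commute: "p * scalar c = scalar c * p"
proof (induction p rule: poly_mapping_add_induct)
  case (single w a)
  show ?case by (simp add: scalar_def mult_single mult.commute)
qed (simp add: algebra_simps)

primrec word_eval :: "('g \<Rightarrow> 'r::monoid_mult) \<Rightarrow> 'g word \<Rightarrow> 'r" where
  "word_eval v (Word ws) = prod_list (map v ws)"

lemma word_eval_0 [simp]: "word_eval v 0 = 1"
  by (simp add: zero_word_def)

lemma word_eval_add: "word_eval v (w + w') = word_eval v w * word_eval v w'"
  by (cases w; cases w') simp

text \<open>The universal property of the free algebra. Scalars are asked to commute only with the
  images of generators: in the ring of all additive maps, used as a target below, they are not
  central.\<close>

locale free_lift =
  fixes \<iota> :: "complex \<Rightarrow> 'r::{ring, monoid_mult}" and v :: "'g \<Rightarrow> 'r"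
  assumes \<iota>_add: "\<iota> (a + b) = \<iota> a + \<iota> b"
    and \<iota>_mult: "\<iota> (a * b) = \<iota> a * \<iota> b"
    and \<iota>_1: "\<iota> 1 = 1"
    and \<iota>_central: "v g * \<iota> c = \<iota> c * v g"
begin

definition lift :: "'g free_alg \<Rightarrow> 'r" where
  "lift p = (\<Sum>w\<in>Poly_Mapping.keys p. \<iota> (Poly_Mapping.lookup p w) * word_eval v w)"

lemma \<iota>_0: "\<iota> 0 = 0"
  using \<iota>_add[of 0 0] by simp

lemma word_eval_central: "word_eval v w * \<iota> c = \<iota> c * word_eval v w"
proof (cases w)
  case (Word ws)
  have "prod_list (map v ws) * \<iota> c = \<iota> c * prod_list (map v ws)"
    by (induction ws) (simp_all add: mult.assoc, simp add: \<iota>_central flip: mult.assoc)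
  then show ?thesis by (simp add: Word)
qed

lemma lift_single: "lift (Poly_Mapping.single w c) = \<iota> c * word_eval v w"
  by (simp add: lift_def \<iota>_0)

lemma lift_add: "lift (p + q) = lift p + lift q"
  unfolding lift_def
  by (rule setsum_keys_plus_distrib) (simp_all add: \<iota>_0 \<iota>_add distrib_right)

lemma lift_scalar: "lift (scalar c) = \<iota> c"
  by (simp add: scalar_def lift_single)

lemma lift_gen: "lift (gen a) = v a"
  by (simp add: gen_def lift_single \<iota>_1)

lemma lift_0: "lift 0 = 0"
  using lift_add[of 0 0] by simp

lemma lift_1: "lift 1 = 1"
  using lift_scalar[of 1] by (simp add: \<iota>_1)

lemma lift_mult: "lift (p * q) = lift p * lift q"
proof (induction p rule: poly_mapping_add_induct)
  case (single w c)
  show ?case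
  proof (induction q rule: poly_mapping_add_induct)
    case (single w' c')
    have "\<iota> c * (\<iota> c' * word_eval v w) * word_eval v w' =
        \<iota> c * (word_eval v w * \<iota> c') * word_eval v w'"
      by (simp add: word_eval_central)
    then show ?case
      by (simp add: mult_single lift_single \<iota>_mult word_eval_add mult.assoc)
  qed (simp add: distrib_left lift_add)
qed (simp add: distrib_right lift_add)

lemma lift_uminus: "lift (- p) = - lift p"
  using lift_add[of p "- p"] by (simp add: lift_0 eq_neg_iff_add_eq_0 add.commute)

lemma lift_diff: "lift (p - q) = lift p - lift q"
  using lift_add[of p "- q"] by (simp add: lift_uminus)

lemma lift_power: "lift (p ^ n) = lift p ^ n"
  by (induction n) (simp_all add: lift_1 lift_mult)

lemma lift_sum: "lift (\<Sum>i\<in>A. p i) = (\<Sum>i\<in>A. lift (p i))"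
  by (induction A rule: infinite_finite_induct) (simp_all add: lift_0 lift_add)

lemma lift_poly_at:
  "lift (poly_at f p) = (\<Sum>i\<le>Polynomial.degree f. \<iota> (Polynomial.coeff f i) * lift p ^ i)"
  by (simp add: poly_at_def lift_sum lift_mult lift_scalar lift_power)

end


section \<open>Presented algebras\<close>

lemma relation_ideal_superset: "rels \<subseteq> relation_ideal rels"
  unfolding relation_ideal_def
  by (rule ring.genideal_self[OF ring_free_algebra]) (simp add: free_algebra_def)

lemma relation_ideal_add:
  "p \<in> relation_ideal rels \<Longrightarrow> q \<in> relation_ideal rels \<Longrightarrow> p + q \<in> relation_ideal rels"
  using additive_subgroup.a_closed[OF ideal.axioms(1)[OF ideal_relation_ideal]]
  by (fastforce simp: free_algebra_def)

lemma relation_ideal_0: "0 \<in> relation_ideal rels"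
  using additive_subgroup.zero_closed[OF ideal.axioms(1)[OF ideal_relation_ideal, of rels]]
  by (simp add: free_algebra_def)

lemma relation_ideal_mult_left: "p \<in> relation_ideal rels \<Longrightarrow> a * p \<in> relation_ideal rels"
  using ideal.I_l_closed[OF ideal_relation_ideal, of p rels a] by (simp add: free_algebra_def)

lemma relation_ideal_mult_right: "p \<in> relation_ideal rels \<Longrightarrow> p * a \<in> relation_ideal rels"
  using ideal.I_r_closed[OF ideal_relation_ideal, of p rels a] by (simp add: free_algebra_def)

lemma relation_ideal_uminus: "p \<in> relation_ideal rels \<Longrightarrow> - p \<in> relation_ideal rels"
  using relation_ideal_mult_left[of p rels "- 1"] by simp

lemma relation_ideal_diff:
  "p \<in> relation_ideal rels \<Longrightarrow> q \<in> relation_ideal rels \<Longrightarrow> p - q \<in> relation_ideal rels"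
  using relation_ideal_add[OF _ relation_ideal_uminus] by fastforce

text \<open>Meant for kernels and preimages of ideals. Closure under negation follows from
  multiplication by \<open>- 1\<close>.\<close>

lemma relation_ideal_minimal:
  assumes zero: "0 \<in> J" and add: "\<And>p q. p \<in> J \<Longrightarrow> q \<in> J \<Longrightarrow> p + q \<in> J"
    and left: "\<And>a p. p \<in> J \<Longrightarrow> a * p \<in> J" and right: "\<And>a p. p \<in> J \<Longrightarrow> p * a \<in> J"
    and rels: "rels \<subseteq> J"
  shows "relation_ideal rels \<subseteq> J"
proof -
  have minus: "- p \<in> J" if "p \<in> J" for p
    using left[OF that, of "- 1"] by simp
  interpret R: ring "free_algebra :: (complex, 'a free_alg) module"
    by (rule ring_free_algebra)
  have inv: "\<ominus>\<^bsub>free_algebra\<^esub> p = - p" for p :: "'a free_alg"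
    by (rule R.minus_equality) (simp_all add: free_algebra_def)
  have "ideal J free_algebra"
  proof (rule idealI[OF ring_free_algebra])
    show "subgroup J (add_monoid free_algebra)"
    proof (rule R.add.subgroupI)
      show "J \<subseteq> carrier free_algebra" by (simp add: free_algebra_def)
      show "J \<noteq> {}" using zero by blast
      show "\<ominus>\<^bsub>free_algebra\<^esub> p \<in> J" if "p \<in> J" for p using that by (simp add: inv minus)
      show "p \<oplus>\<^bsub>free_algebra\<^esub> q \<in> J" if "p \<in> J" "q \<in> J" for p q
        using that by (simp add: free_algebra_def add)
    qed
  qed (simp_all add: free_algebra_def left right)
  then show ?thesis
    unfolding relation_ideal_def by (rule R.genideal_minimal[OF _ rels])
qed

text \<open>The kernel of a homomorphism is a two-sided ideal.\<close>

lemma (in free_lift) lift_relation_ideal: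
  assumes "\<And>q. q \<in> rels \<Longrightarrow> lift q = 0" and "p \<in> relation_ideal rels"
  shows "lift p = 0"
proof -
  have "relation_ideal rels \<subseteq> {q. lift q = 0}"
    by (rule relation_ideal_minimal) (auto simp: lift_0 lift_add lift_mult assms(1))
  then show ?thesis using assms(2) by blast
qed

section \<open>Quotient map and operations on residue classes\<close>

definition residue :: "'g free_alg set \<Rightarrow> 'g free_alg \<Rightarrow> 'g free_alg set" where
  "residue rels p = relation_ideal rels +>\<^bsub>free_algebra\<^esub> p"

lemma residue_conv: "residue rels p = (\<lambda>i. i + p) ` relation_ideal rels"
  by (auto simp: residue_def a_r_coset_def' free_algebra_def)

lemma residue_eq_iff: "residue rels p = residue rels q \<longleftrightarrow> p - q \<in> relation_ideal rels"
proof
  assume "residue rels p = residue rels q"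
  then have "0 + p \<in> residue rels q"
    using relation_ideal_0 unfolding residue_conv by blast
  then show "p - q \<in> relation_ideal rels" by (auto simp: residue_conv)
next
  assume pq: "p - q \<in> relation_ideal rels"
  have *: "residue rels a \<subseteq> residue rels b" if "a - b \<in> relation_ideal rels" for a b
  proof
    fix x assume "x \<in> residue rels a"
    then obtain i where "i \<in> relation_ideal rels" "x = i + a" by (auto simp: residue_conv)
    then show "x \<in> residue rels b"
      using relation_ideal_add[OF _ that, of i]
      by (auto simp: residue_conv intro!: image_eqI[of _ _ "i + (a - b)"])
  qed
  have "q - p \<in> relation_ideal rels" using relation_ideal_uminus[OF pq] by simp
  then show "residue rels p = residue rels q" by (intro equalityI * pq)
qed

lemma carrier_presented: "carrier (presented_algebra rels) = range (residue rels)"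
  by (auto simp: presented_algebra_def ring.defs FactRing_def A_RCOSETS_def RCOSETS_def
      residue_def a_r_coset_def free_algebra_def)

lemma one_presented: "\<one>\<^bsub>presented_algebra rels\<^esub> = residue rels 1"
  by (simp add: presented_algebra_def ring.defs FactRing_simps residue_def)
    (simp add: free_algebra_def)

lemma mult_presented:
  "residue rels p \<otimes>\<^bsub>presented_algebra rels\<^esub> residue rels q = residue rels (p * q)"
  using ideal.rcoset_mult_add[OF ideal_relation_ideal, of p q rels]
  by (simp add: presented_algebra_def ring.defs FactRing_simps residue_def)
    (simp add: free_algebra_def)

lemma add_presented:
  "residue rels p \<oplus>\<^bsub>presented_algebra rels\<^esub> residue rels q = residue rels (p + q)"
  using ideal.a_rcos_sum[OF ideal_relation_ideal, of p q rels]
  by (simp add: presented_algebra_def ring.defs FactRing_simps residue_def)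
    (simp add: free_algebra_def)

lemma smult_presented:
  "c \<odot>\<^bsub>presented_algebra rels\<^esub> residue rels p = residue rels (scalar c * p)"
  unfolding residue_def by (rule presented_algebra_smult)

section \<open>Substitutions and isomorphisms of presented algebras\<close>

interpretation subst: free_lift scalar v for v :: "'a \<Rightarrow> 'b free_alg"
  by unfold_locales (rule scalar_add scalar_mult scalar_1 scalar_commute)+

text \<open>The preimage of an ideal under a substitution is an ideal.\<close>

lemma subst_relation_ideal:
  assumes "\<And>q. q \<in> rels \<Longrightarrow> subst.lift v q \<in> relation_ideal rels'" and "p \<in> relation_ideal rels"
  shows "subst.lift v p \<in> relation_ideal rels'"
proof -
  have "relation_ideal rels \<subseteq> {q. subst.lift v q \<in> relation_ideal rels'}"
    by (rule relation_ideal_minimal)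
      (auto simp: subst.lift_0 subst.lift_add subst.lift_mult relation_ideal_0 relation_ideal_add
        relation_ideal_mult_left relation_ideal_mult_right assms(1))
  then show ?thesis using assms(2) by blast
qed

text \<open>The elements fixed modulo the ideal by the composite substitution form a subalgebra,
  which contains all generators by assumption.\<close>

lemma subst_subst_cong_id:
  assumes "\<And>a. subst.lift v' (v a) - gen a \<in> relation_ideal rels"
  shows "subst.lift v' (subst.lift v p) - p \<in> relation_ideal rels"
proof (induction p rule: free_alg_induct)
  case (scalar c)
  show ?case by (simp add: subst.lift_scalar relation_ideal_0)
next
  case (gen a)
  show ?case by (simp add: subst.lift_gen assms)
next
  case (add p q)
  then show ?case
    using relation_ideal_add[OF add.IH] by (simp add: subst.lift_add algebra_simps)
next
  case (mult p q)
  let ?f = "\<lambda>p. subst.lift v' (subst.lift v p)"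
  \<comment> \<open>Splits \<open>?f p * ?f q - p * q\<close> into two terms, each with a factor
    known from the induction hypotheses.\<close>
  have "?f p * (?f q - q) + (?f p - p) * q \<in> relation_ideal rels"
    by (intro relation_ideal_add relation_ideal_mult_left relation_ideal_mult_right mult.IH)
  then show ?case by (simp add: subst.lift_mult algebra_simps)
qed

lemma presented_algebra_isomorphicI:
  assumes v: "\<And>q. q \<in> rels \<Longrightarrow> subst.lift v q \<in> relation_ideal rels'"
    and v': "\<And>q. q \<in> rels' \<Longrightarrow> subst.lift v' q \<in> relation_ideal rels"
    and v'v: "\<And>a. subst.lift v' (v a) - gen a \<in> relation_ideal rels"
    and vv': "\<And>b. subst.lift v (v' b) - gen b \<in> relation_ideal rels'"
  shows "presented_algebra rels \<cong>\<^sub>a\<^sub>l\<^sub>g presented_algebra rels'"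
proof -
  \<comment> \<open>The value does not depend on the chosen representative, because substitution by
    \<open>v\<close> carries one ideal into the other.\<close>
  define \<phi> where "\<phi> X = residue rels' (subst.lift v (SOME p. X = residue rels p))" for X
  have \<phi>: "\<phi> (residue rels p) = residue rels' (subst.lift v p)" for p
  proof -
    define q where "q = (SOME q. residue rels p = residue rels q)"
    have "residue rels p = residue rels q"
      unfolding q_def by (rule someI) (rule refl)
    then have "q - p \<in> relation_ideal rels" by (simp flip: residue_eq_iff)
    then have "subst.lift v (q - p) \<in> relation_ideal rels'"
      using subst_relation_ideal v by blast
    then have "residue rels' (subst.lift v q) = residue rels' (subst.lift v p)"
      by (simp add: residue_eq_iff subst.lift_diff)
    then show ?thesis by (simp add: \<phi>_def q_def)
  qed
  have "inj_on \<phi> (range (residue rels))"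
  proof (rule inj_onI, clarify)
    fix p q
    assume "\<phi> (residue rels p) = \<phi> (residue rels q)"
    then have "subst.lift v (p - q) \<in> relation_ideal rels'"
      by (simp add: \<phi> residue_eq_iff subst.lift_diff)
    then have "subst.lift v' (subst.lift v (p - q)) \<in> relation_ideal rels"
      using subst_relation_ideal v' by blast
    then have "p - q \<in> relation_ideal rels"
      using relation_ideal_diff[OF _ subst_subst_cong_id[OF v'v, of "p - q"]] by fastforce
    then show "residue rels p = residue rels q" by (simp add: residue_eq_iff)
  qed
  moreover have "\<phi> ` range (residue rels) = range (residue rels')"
  proof -
    have "residue rels' q = \<phi> (residue rels (subst.lift v' q))" for q
      using subst_subst_cong_id[OF vv', of q] by (simp add: \<phi> flip: residue_eq_iff)
    then have "residue rels' q \<in> \<phi> ` range (residue rels)" for q by (metis imageI rangeI)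
    then show ?thesis by (auto simp: \<phi>)
  qed
  ultimately have "\<phi> \<in> algebra_iso (presented_algebra rels) (presented_algebra rels')"
    by (auto simp: algebra_iso_def ring_iso_def ring_hom_def bij_betw_def carrier_presented \<phi>
        one_presented mult_presented add_presented smult_presented
        subst.lift_mult subst.lift_add subst.lift_1 subst.lift_scalar)
  then show ?thesis by (auto simp: algebra_isomorphic_def)
qed

text \<open>\<open>\<theta>\<close> chooses representatives for the inverse isomorphism, so it runs
  from the free algebra of \<open>rels'\<close> to that of \<open>rels\<close> and is a homomorphism
  only modulo the ideal. Later arguments can thus work with elements instead of cosets.\<close>

lemma presented_algebra_isomorphic_lifting:
  assumes "presented_algebra rels \<cong>\<^sub>a\<^sub>l\<^sub>g presented_algebra rels'"
  obtains \<theta> where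
    "\<And>p q. \<theta> (p + q) - (\<theta> p + \<theta> q) \<in> relation_ideal rels"
    "\<And>p q. \<theta> (p * q) - \<theta> p * \<theta> q \<in> relation_ideal rels"
    "\<And>c p. \<theta> (scalar c * p) - scalar c * \<theta> p \<in> relation_ideal rels"
    "\<theta> 1 - 1 \<in> relation_ideal rels"
    "\<And>p. p \<in> relation_ideal rels' \<Longrightarrow> \<theta> p \<in> relation_ideal rels"
    "\<And>q. \<exists>p. \<theta> p - q \<in> relation_ideal rels"
proof -
  let ?A = "presented_algebra rels" and ?B = "presented_algebra rels'"
  obtain \<phi> where \<phi>: "\<phi> \<in> algebra_iso ?A ?B"
    using assms by (auto simp: algebra_isomorphic_def)
  have inj: "inj_on \<phi> (range (residue rels))" and
    im: "\<phi> ` range (residue rels) = range (residue rels')"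
    using \<phi> by (auto simp: algebra_iso_def ring_iso_def bij_betw_def carrier_presented)
  have mult: "\<phi> (residue rels (p * q)) = \<phi> (residue rels p) \<otimes>\<^bsub>?B\<^esub> \<phi> (residue rels q)"
    and add: "\<phi> (residue rels (p + q)) = \<phi> (residue rels p) \<oplus>\<^bsub>?B\<^esub> \<phi> (residue rels q)"
    and one: "\<phi> (residue rels 1) = residue rels' 1" for p q
    using \<phi> by (auto simp: algebra_iso_def ring_iso_def ring_hom_def carrier_presented
        simp flip: one_presented mult_presented add_presented)
  have smult: "\<phi> (residue rels (scalar c * p)) = c \<odot>\<^bsub>?B\<^esub> \<phi> (residue rels p)" for c p
    using \<phi> by (auto simp: algebra_iso_def carrier_presented simp flip: smult_presented)
  have cong: "p - q \<in> relation_ideal rels"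
    if "\<phi> (residue rels p) = \<phi> (residue rels q)" for p q
    using inj that by (auto simp: inj_on_def simp flip: residue_eq_iff)
  have "\<exists>q. \<phi> (residue rels q) = residue rels' p" for p
  proof -
    have "residue rels' p \<in> \<phi> ` range (residue rels)" unfolding im by simp
    then obtain q where "residue rels' p = \<phi> (residue rels q)" by blast
    then show ?thesis by metis
  qed
  then obtain \<theta> where \<theta>: "\<And>p. \<phi> (residue rels (\<theta> p)) = residue rels' p" by metis
  have zero: "\<phi> (residue rels 0) = residue rels' 0"
    using smult[of 0 "\<theta> 0"] by (simp add: \<theta> smult_presented)
  show thesis
  proof
    show "\<theta> (p + q) - (\<theta> p + \<theta> q) \<in> relation_ideal rels" for p q
      by (rule cong) (simp add: add \<theta> add_presented)
    show "\<theta> (p * q) - \<theta> p * \<theta> q \<in> relation_ideal rels" for p q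
      by (rule cong) (simp add: mult \<theta> mult_presented)
    show "\<theta> (scalar c * p) - scalar c * \<theta> p \<in> relation_ideal rels" for c p
      by (rule cong) (simp add: smult \<theta> smult_presented)
    show "\<theta> 1 - 1 \<in> relation_ideal rels"
      by (rule cong) (simp add: \<theta> one)
    show "\<theta> p \<in> relation_ideal rels" if "p \<in> relation_ideal rels'" for p
    proof -
      have "residue rels' p = residue rels' 0" using that by (simp add: residue_eq_iff)
      then show ?thesis using cong[of "\<theta> p" 0] by (simp add: \<theta> zero)
    qed
    show "\<exists>p. \<theta> p - q \<in> relation_ideal rels" for q
    proof -
      have "\<phi> (residue rels q) \<in> range (residue rels')" using im by blast
      then obtain p where "\<phi> (residue rels q) = residue rels' p" by blast
      then have "\<theta> p - q \<in> relation_ideal rels" by (intro cong) (simp add: \<theta>)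
      then show ?thesis by blast
    qed
  qed
qed


section \<open>Polynomials of degree at most one\<close>

definition heisenberg_rels :: "complex poly \<Rightarrow> heisenberg_gen free_alg set" where
  "heisenberg_rels f =
     {gen Gh * gen Gx - gen Gx * poly_at f (gen Gh),
      gen Gy * gen Gh - poly_at f (gen Gh) * gen Gy,
      (gen Gy * gen Gx - gen Gx * gen Gy) - (poly_at f (gen Gh) - gen Gh)}"

lemma generalized_heisenberg_conv: "generalized_heisenberg f = presented_algebra (heisenberg_rels f)"
  by (simp add: generalized_heisenberg_def heisenberg_rels_def Let_def)

definition down_up_rels ::
    "complex poly \<Rightarrow> complex \<Rightarrow> complex \<Rightarrow> complex \<Rightarrow> down_up_gen free_alg set" where
  "down_up_rels g r s \<gamma> =
     {gen Gd * gen GH - scalar r * gen GH * gen Gd + scalar \<gamma> * gen Gd,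
      gen GH * gen Gu - scalar r * gen Gu * gen GH + scalar \<gamma> * gen Gu,
      gen Gd * gen Gu - scalar s * gen Gu * gen Gd + poly_at g (gen GH)}"

lemma generalized_down_up_conv:
  "generalized_down_up g r s \<gamma> = presented_algebra (down_up_rels g r s \<gamma>)"
  by (simp add: generalized_down_up_def down_up_rels_def Let_def)

lemma poly_at_degree_le_1:
  assumes "Polynomial.degree f \<le> 1"
  shows "poly_at f p = scalar (Polynomial.coeff f 0) + scalar (Polynomial.coeff f 1) * p"
proof -
  have "poly_at f p = (\<Sum>i\<le>1. scalar (Polynomial.coeff f i) * p ^ i)"
    unfolding poly_at_def using assms
    by (intro sum.mono_neutral_left) (auto simp: coeff_eq_0)
  then show ?thesis by simp
qed

text \<open>With \<open>f = a h + b\<close>, the first relation becomes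
  \<open>H u - a u H - b u = 0\<close>, whence \<open>r = a\<close> and
  \<open>\<gamma> = - b\<close>; the third becomes \<open>d u - u d + (H - f) = 0\<close>, whence
  \<open>s = 1\<close> and \<open>g = H - f\<close>.\<close>

lemma heisenberg_isomorphic_down_up:
  assumes f: "Polynomial.degree f \<le> 1"
  shows "generalized_heisenberg f \<cong>\<^sub>a\<^sub>l\<^sub>g
    generalized_down_up ([:0, 1:] - f) (Polynomial.coeff f 1) 1 (- Polynomial.coeff f 0)"
proof -
  define a b where "a = Polynomial.coeff f 1" and "b = Polynomial.coeff f 0"
  define v where "v c = (case c of Gx \<Rightarrow> gen Gu | Gy \<Rightarrow> gen Gd | Gh \<Rightarrow> gen GH)" for c
  define v' where "v' c = (case c of Gu \<Rightarrow> gen Gx | Gd \<Rightarrow> gen Gy | GH \<Rightarrow> gen Gh)" for c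
  have v [simp]: "v Gx = gen Gu" "v Gy = gen Gd" "v Gh = gen GH"
    and v' [simp]: "v' Gu = gen Gx" "v' Gd = gen Gy" "v' GH = gen Gh"
    by (simp_all add: v_def v'_def)
  have pf: "poly_at f p = scalar b + scalar a * p" for p :: "'g free_alg"
    by (simp add: poly_at_degree_le_1[OF f] a_def b_def)
  have "Polynomial.degree ([:0, 1:] - f) \<le> 1"
    using f by (intro degree_diff_le) auto
  then have pg: "poly_at ([:0, 1:] - f) p = - scalar b + (p - scalar a * p)" for p :: "'g free_alg"
    by (simp add: poly_at_degree_le_1 a_def b_def scalar_uminus scalar_diff left_diff_distrib)
  note simps = heisenberg_rels_def down_up_rels_def pf pg subst.lift_add subst.lift_mult
    subst.lift_diff subst.lift_uminus subst.lift_gen subst.lift_scalar subst.lift_1 scalar_uminus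
    algebra_simps
  \<comment> \<open>Collecting scalars on the left brings both sets of relations to the same normal
    form.\<close>
  have comm: "gen a * scalar c = scalar c * gen a" "gen a * (scalar c * q) = scalar c * (gen a * q)"
    for a :: 'g and q c
    by (rule scalar_commute, metis mult.assoc scalar_commute)
  \<comment> \<open>The renaming matches the relations one by one, so no computation inside the
    ideals is required.\<close>
  have "subst.lift v ` heisenberg_rels f = down_up_rels ([:0, 1:] - f) a 1 (- b)"
    by (simp add: simps comm insert_commute)
  then have 1: "subst.lift v q \<in> relation_ideal (down_up_rels ([:0, 1:] - f) a 1 (- b))"
    if "q \<in> heisenberg_rels f" for q
    using that relation_ideal_superset by blast
  have "subst.lift v' ` down_up_rels ([:0, 1:] - f) a 1 (- b) = heisenberg_rels f"
    by (simp add: simps comm insert_commute)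
  then have 2: "subst.lift v' q \<in> relation_ideal (heisenberg_rels f)"
    if "q \<in> down_up_rels ([:0, 1:] - f) a 1 (- b)" for q
    using that relation_ideal_superset by blast
  have "subst.lift v' (v c) = gen c" for c by (cases c) (simp_all add: subst.lift_gen)
  moreover have "subst.lift v (v' c) = gen c" for c by (cases c) (simp_all add: subst.lift_gen)
  ultimately have "presented_algebra (heisenberg_rels f) \<cong>\<^sub>a\<^sub>l\<^sub>g
      presented_algebra (down_up_rels ([:0, 1:] - f) a 1 (- b))"
    by (intro presented_algebra_isomorphicI[of _ v _ v'] 1 2) (simp_all add: relation_ideal_0)
  then show ?thesis
    by (simp add: generalized_heisenberg_conv generalized_down_up_conv a_def b_def)
qed


section \<open>Exponential growth of generalized Heisenberg algebras\<close>

text \<open>Additive endomorphisms under composition form a ring of the class that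
  \<open>free_lift\<close> expects; complex scalars enter through
  \<open>verma_scalar\<close>.\<close>

typedef (overloaded) 'm endo = "{f :: 'm::ab_group_add \<Rightarrow> 'm. \<forall>x y. f (x + y) = f x + f y}"
  morphisms endo_apply Endo
  by (rule exI[of _ id]) simp

setup_lifting type_definition_endo

instantiation endo :: (ab_group_add) "{ring, monoid_mult}"
begin

lift_definition zero_endo :: "'a endo" is "\<lambda>x. 0" by simp
lift_definition one_endo :: "'a endo" is "\<lambda>x. x" by simp
lift_definition plus_endo :: "'a endo \<Rightarrow> 'a endo \<Rightarrow> 'a endo" is "\<lambda>f g x. f x + g x"
  by (simp add: algebra_simps)
lift_definition minus_endo :: "'a endo \<Rightarrow> 'a endo \<Rightarrow> 'a endo" is "\<lambda>f g x. f x - g x"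
  by (simp add: algebra_simps)
lift_definition uminus_endo :: "'a endo \<Rightarrow> 'a endo" is "\<lambda>f x. - f x"
  by (simp add: algebra_simps)
lift_definition times_endo :: "'a endo \<Rightarrow> 'a endo \<Rightarrow> 'a endo" is "\<lambda>f g x. f (g x)"
  by simp

instance
  by standard (transfer; simp add: algebra_simps fun_eq_iff)+

end

lemmas endo_apply_simps =
  zero_endo.rep_eq one_endo.rep_eq plus_endo.rep_eq minus_endo.rep_eq uminus_endo.rep_eq
  times_endo.rep_eq

lemma endo_apply_sum: "endo_apply (\<Sum>i\<in>A. f i) x = (\<Sum>i\<in>A. endo_apply (f i) x)"
  by (induction A rule: infinite_finite_induct) (simp_all add: endo_apply_simps)

lemma sum_fun_apply: "(\<Sum>i\<in>A. f i) x = (\<Sum>i\<in>A. f i x)"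
  by (induction A rule: infinite_finite_induct) simp_all

text \<open>The Verma-type module \<open>\<Oplus>\<^sub>n x\<^sup>n \<complex>[h]\<close> on which \<open>y\<close> kills the component \<open>n = 0\<close>; the
  relation \<open>h x\<^sup>n = x\<^sup>n f\<^sup>n(h)\<close>, with \<open>f\<^sup>n\<close> the iterate, dictates the actions.\<close>

definition iterate_poly :: "complex poly \<Rightarrow> nat \<Rightarrow> complex poly" where
  "iterate_poly f n = (pcompose f ^^ n) [:0, 1:]"

lemma iterate_poly_0 [simp]: "iterate_poly f 0 = [:0, 1:]"
  and iterate_poly_Suc [simp]: "iterate_poly f (Suc n) = pcompose f (iterate_poly f n)"
  by (simp_all add: iterate_poly_def)

lemma degree_iterate_poly: "Polynomial.degree (iterate_poly f n) = Polynomial.degree f ^ n"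
  by (induction n) (simp_all add: degree_pcompose)

type_synonym verma = "nat \<Rightarrow> complex poly"

definition verma_scalar :: "complex \<Rightarrow> verma endo" where
  "verma_scalar c = Endo (\<lambda>m n. Polynomial.smult c (m n))"
definition verma_x :: "verma endo" where
  "verma_x = Endo (\<lambda>m n. if n = 0 then 0 else m (n - 1))"
definition verma_h :: "complex poly \<Rightarrow> verma endo" where
  "verma_h f = Endo (\<lambda>m n. iterate_poly f n * m n)"
text \<open>The factor comes from \<open>y x^(n+1) = x^(n+1) y + x^n (f^(n+1)(h) - h)\<close>:
  moving \<open>y\<close> past each \<open>x\<close> leaves a term \<open>f(h) - h\<close>, and
  these telescope once pushed to the right.\<close>

definition verma_y :: "complex poly \<Rightarrow> verma endo" where
  "verma_y f = Endo (\<lambda>m n. (iterate_poly f (Suc n) - [:0, 1:]) * m (Suc n))"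

primrec verma_gen :: "complex poly \<Rightarrow> heisenberg_gen \<Rightarrow> verma endo" where
  "verma_gen f Gx = verma_x"
| "verma_gen f Gy = verma_y f"
| "verma_gen f Gh = verma_h f"

lemma verma_apply:
  "endo_apply (verma_scalar c) m n = Polynomial.smult c (m n)"
  "endo_apply verma_x m 0 = 0"
  "endo_apply verma_x m (Suc k) = m k"
  "endo_apply (verma_h f) m n = iterate_poly f n * m n"
  "endo_apply (verma_y f) m n = (iterate_poly f (Suc n) - [:0, 1:]) * m (Suc n)"
  by (simp_all add: verma_scalar_def verma_x_def verma_h_def verma_y_def Endo_inverse fun_eq_iff
      smult_add_right distrib_left)

lemma endo_eqI:
  fixes a b :: "verma endo"
  assumes "\<And>m n. endo_apply a m n = endo_apply b m n"
  shows "a = b"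
  using assms by (metis endo_apply_inject ext)

interpretation verma: free_lift verma_scalar "verma_gen f" for f
proof
  show "verma_gen f a * verma_scalar c = verma_scalar c * verma_gen f a" for a c
  proof (cases a)
    case Gx
    have "endo_apply (verma_x * verma_scalar c) m n = endo_apply (verma_scalar c * verma_x) m n" for m n
      by (cases n) (simp_all add: endo_apply_simps verma_apply)
    then show ?thesis by (simp add: Gx endo_eqI)
  qed (auto intro!: endo_eqI simp: endo_apply_simps verma_apply)
qed (auto intro!: endo_eqI simp: endo_apply_simps verma_apply smult_add_left)

lemma verma_h_power: "endo_apply (verma_h f ^ i) m n = iterate_poly f n ^ i * m n"
  by (induction i) (simp_all add: endo_apply_simps verma_apply)

lemma pcompose_conv_sum:
  "pcompose f q = (\<Sum>i\<le>Polynomial.degree f. Polynomial.smult (Polynomial.coeff f i) (q ^ i))"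
  for f q :: "complex poly"
  by (simp add: pcompose_altdef poly_altdef coeff_map_poly degree_map_poly)

lemma verma_poly_at:
  "endo_apply (verma.lift f (poly_at q (gen Gh))) m n = pcompose q (iterate_poly f n) * m n"
  by (simp add: verma.lift_poly_at verma.lift_gen endo_apply_sum sum_fun_apply endo_apply_simps
      verma_apply verma_h_power pcompose_conv_sum sum_distrib_right)

text \<open>On component \<open>n\<close> the element \<open>f(h)\<close> acts as the next iterate,
  so in \<open>y x - x y\<close> the two terms \<open>h\<close> cancel and
  \<open>f^(n+1) - f^n\<close> remains. Component 0 is a separate case, since the image of
  \<open>x\<close> vanishes there.\<close>

lemma verma_heisenberg_rels:
  assumes "q \<in> heisenberg_rels f"
  shows "verma.lift f q = 0"
proof (rule endo_eqI)
  show "endo_apply (verma.lift f q) m n = endo_apply 0 m n" for m n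
    using assms unfolding heisenberg_rels_def insert_iff empty_iff
    by (elim disjE FalseE; hypsubst; cases n)
      (simp_all add: verma.lift_add verma.lift_diff verma.lift_mult verma.lift_gen endo_apply_simps
        verma_apply verma_poly_at algebra_simps del: mult_pCons_left mult_pCons_right)
qed

lemmas verma_relation_ideal = verma.lift_relation_ideal[OF verma_heisenberg_rels]

text \<open>A bit says whether \<open>h\<close> precedes the next \<open>x\<close>. The monoid is
  general because the same words are formed from generators of one free algebra and from their
  preimages in another.\<close>

primrec code_word :: "'r::monoid_mult \<Rightarrow> 'r \<Rightarrow> bool list \<Rightarrow> 'r" where
  "code_word x h [] = 1"
| "code_word x h (b # bs) = (if b then h else 1) * (x * code_word x h bs)"

text \<open>A leading \<open>h\<close> has \<open>Suc (length bs)\<close> letters \<open>x\<close>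
  to its right, and moving it past them applies \<open>f\<close> that often.\<close>

primrec code_poly :: "complex poly \<Rightarrow> bool list \<Rightarrow> complex poly" where
  "code_poly f [] = 1"
| "code_poly f (b # bs) =
     (if b then iterate_poly f (Suc (length bs)) else 1) * code_poly f bs"

text \<open>The bits are base \<open>d\<close> digits, leading digit first; the units digit is 0
  because each \<open>h\<close> has at least one \<open>x\<close> to its right.\<close>

primrec code_degree :: "nat \<Rightarrow> bool list \<Rightarrow> nat" where
  "code_degree d [] = 0"
| "code_degree d (b # bs) = (if b then d ^ Suc (length bs) else 0) + code_degree d bs"

text \<open>The test vector is 1 in component 0. Each \<open>x\<close> raises the component by one,
  so an \<open>h\<close> acts on the component that counts the \<open>x\<close> to its
  right.\<close>

lemma verma_code_word:
  "endo_apply (verma.lift f (code_word (gen Gx) (gen Gh) bs)) (\<lambda>k. if k = 0 then 1 else 0) n =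
     (if n = length bs then code_poly f bs else 0)"
proof (induction bs arbitrary: n)
  case Nil
  show ?case by (simp add: verma.lift_1 endo_apply_simps)
next
  case (Cons b bs)
  show ?case
    by (cases n) (simp_all add: verma.lift_mult verma.lift_gen verma.lift_1 endo_apply_simps
        verma_apply Cons.IH)
qed

lemma code_poly_degree:
  assumes "Polynomial.degree f \<noteq> 0"
  shows "code_poly f bs \<noteq> 0 \<and> Polynomial.degree (code_poly f bs) = code_degree (Polynomial.degree f) bs"
proof (induction bs)
  case (Cons b bs)
  have *: "Polynomial.degree (pcompose f (iterate_poly f k)) = Polynomial.degree f ^ Suc k" for k
    using degree_iterate_poly[of f "Suc k"] by simp
  then have "pcompose f (iterate_poly f (length bs)) \<noteq> 0"
    using assms by (metis degree_0 power_not_zero)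
  then show ?case using Cons by (simp add: degree_mult_eq *)
qed simp

text \<open>The lower digits stay below the leading power, so the total is below twice that power
  and hence below the next one.\<close>

lemma code_degree_less:
  assumes "d \<ge> 2"
  shows "code_degree d bs < d ^ Suc (length bs)"
proof (induction bs)
  case (Cons b bs)
  have "code_degree d (b # bs) < 2 * d ^ Suc (length bs)" using Cons by simp
  also have "\<dots> \<le> d ^ Suc (length (b # bs))" using assms by simp
  finally show ?case .
qed (use assms in simp)

text \<open>The leading bit can be read off, because its power of \<open>d\<close> exceeds
  everything the later digits contribute.\<close>

lemma inj_on_code_degree:
  assumes "d \<ge> 2"
  shows "inj_on (code_degree d) {bs. length bs = n}"
proof -
  have "bs = bs'" if "length bs = length bs'" "code_degree d bs = code_degree d bs'" for bs bs'
    using that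
  proof (induction bs bs' rule: list_induct2)
    case (Cons b bs b' bs')
    then show ?case
      using code_degree_less[OF assms, of bs] code_degree_less[OF assms, of bs']
      by (auto split: if_splits)
  qed simp
  then show ?thesis by (auto simp: inj_on_def)
qed

section \<open>Vector spaces and linear independence by degree\<close>

interpretation poly_vs: vector_space "Polynomial.smult :: complex \<Rightarrow> complex poly \<Rightarrow> complex poly"
  by unfold_locales (simp_all add: smult_add_right smult_add_left)

interpretation free_vs: vector_space "\<lambda>c (p :: 'g free_alg). scalar c * p"
  by unfold_locales (simp_all add: distrib_left distrib_right scalar_add scalar_mult mult.assoc)

text \<open>Among the terms with nonzero scalar, the one of largest degree is unique, so its leading
  coefficient survives in the sum.\<close>

lemma independent_distinct_degrees:
  assumes fin: "finite S" and inj: "inj_on Polynomial.degree S" and nz: "0 \<notin> S"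
  shows "\<not> poly_vs.dependent S"
proof (rule poly_vs.independent_if_scalars_zero[OF fin])
  fix u p
  assume sum: "(\<Sum>p\<in>S. Polynomial.smult (u p) p) = 0" and p: "p \<in> S"
  show "u p = 0"
  proof (rule ccontr)
    assume "u p \<noteq> 0"
    define T where "T = {p \<in> S. u p \<noteq> 0}"
    have T: "finite T" "T \<noteq> {}" using fin p \<open>u p \<noteq> 0\<close> by (auto simp: T_def)
    then have "Max (Polynomial.degree ` T) \<in> Polynomial.degree ` T" by (intro Max_in) auto
    then obtain q where q: "q \<in> T" and "Polynomial.degree q = Max (Polynomial.degree ` T)"
      by auto
    then have max: "Polynomial.degree r \<le> Polynomial.degree q" if "r \<in> T" for r
      using that T by simp
    have "u r * Polynomial.coeff r (Polynomial.degree q) = 0" if "r \<in> S - {q}" for r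
    proof (cases "u r = 0")
      case False
      then have "Polynomial.degree r < Polynomial.degree q"
        using max[of r] that q inj by (force simp: T_def inj_on_def le_less)
      then show ?thesis by (simp add: coeff_eq_0)
    qed simp
    then have "(\<Sum>r\<in>S - {q}. u r * Polynomial.coeff r (Polynomial.degree q)) = 0"
      by (intro sum.neutral) blast
    then have "Polynomial.coeff (\<Sum>p\<in>S. Polynomial.smult (u p) p) (Polynomial.degree q) =
        u q * Polynomial.lead_coeff q"
      using q fin by (simp add: coeff_sum T_def sum.remove[of S q])
    then show False using sum q nz by (auto simp: T_def)
  qed
qed


section \<open>Polynomial growth of generalized down-up algebras\<close>

locale down_up =
  fixes g :: "complex poly" and r s \<gamma> :: complex
begin

abbreviation I :: "down_up_gen free_alg set" where "I \<equiv> relation_ideal (down_up_rels g r s \<gamma>)"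

abbreviation (input) d :: "down_up_gen free_alg" where "d \<equiv> gen Gd"
abbreviation (input) u :: "down_up_gen free_alg" where "u \<equiv> gen Gu"
abbreviation (input) H :: "down_up_gen free_alg" where "H \<equiv> gen GH"

text \<open>With this weight for \<open>u\<close> and \<open>d\<close>, and weight 1 for \<open>H\<close>, no relation raises weights when
  read as a rewriting rule towards the monomials \<open>u\<^sup>i H\<^sup>j d\<^sup>k\<close>.\<close>

definition wt :: nat where "wt = Suc (Polynomial.degree g)"

definition mono :: "nat \<times> nat \<times> nat \<Rightarrow> down_up_gen free_alg" where
  "mono = (\<lambda>(i, j, k). u ^ i * (H ^ j * d ^ k))"

definition exps :: "nat \<Rightarrow> (nat \<times> nat \<times> nat) set" where
  "exps m = {(i, j, k). wt * (i + k) + j \<le> m}"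

text \<open>Adjoining the whole ideal makes this the preimage of a filtration of the quotient, so
  rewriting modulo the relations stays inside one linear span.\<close>

definition filt :: "nat \<Rightarrow> down_up_gen free_alg set" where
  "filt m = free_vs.span (mono ` exps m \<union> I)"

lemma filt_add: "p \<in> filt m \<Longrightarrow> q \<in> filt m \<Longrightarrow> p + q \<in> filt m"
  unfolding filt_def by (rule free_vs.span_add)

lemma filt_diff: "p \<in> filt m \<Longrightarrow> q \<in> filt m \<Longrightarrow> p - q \<in> filt m"
  unfolding filt_def by (rule free_vs.span_diff)

lemma filt_scale: "p \<in> filt m \<Longrightarrow> scalar c * p \<in> filt m"
  unfolding filt_def by (rule free_vs.span_scale)

lemma filt_0: "0 \<in> filt m"
  unfolding filt_def by (rule free_vs.span_zero)

lemma filt_sum: "(\<And>i. i \<in> A \<Longrightarrow> p i \<in> filt m) \<Longrightarrow> (\<Sum>i\<in>A. p i) \<in> filt m"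
  unfolding filt_def by (rule free_vs.span_sum)

lemma filt_ideal: "p \<in> I \<Longrightarrow> p \<in> filt m"
  unfolding filt_def by (rule free_vs.span_base) simp

lemma filt_mono: "m \<le> m' \<Longrightarrow> p \<in> filt m \<Longrightarrow> p \<in> filt m'"
  using free_vs.span_mono[of "mono ` exps m \<union> I" "mono ` exps m' \<union> I"]
  by (force simp: filt_def exps_def)

lemma filt_cong: "q \<in> filt m \<Longrightarrow> p - q \<in> I \<Longrightarrow> p \<in> filt m"
  using filt_add[OF filt_ideal, of "p - q" q m] by simp

lemma mono_filt: "wt * (i + k) + j \<le> m \<Longrightarrow> u ^ i * (H ^ j * d ^ k) \<in> filt m"
  unfolding filt_def by (rule free_vs.span_base) (force simp: exps_def mono_def)

text \<open>By linearity it suffices to test monomials; the ideal absorbs the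
  multiplication.\<close>

lemma filt_mult_left:
  assumes "\<And>i j k. wt * (i + k) + j \<le> m \<Longrightarrow> a * (u ^ i * (H ^ j * d ^ k)) \<in> filt m'"
    and "p \<in> filt m"
  shows "a * p \<in> filt m'"
  using assms(2) unfolding filt_def[of m]
proof (induction rule: free_vs.span_induct_alt)
  case base
  show ?case by (simp add: filt_0)
next
  case (step c x y)
  have "a * x \<in> filt m'"
    using step(1) assms(1)
    by (auto simp: exps_def mono_def intro: filt_ideal relation_ideal_mult_left)
  moreover have "a * (scalar c * x + y) = scalar c * (a * x) + a * y"
    by (simp add: distrib_left scalar_commute[of a] flip: mult.assoc)
  ultimately show ?case using step(2) by (simp add: filt_add filt_scale)
qed

section \<open>Left multiplication by the generators\<close>

lemma u_filt: "p \<in> filt m \<Longrightarrow> u * p \<in> filt (m + wt)"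
proof (rule filt_mult_left)
  show "u * (u ^ i * (H ^ j * d ^ k)) \<in> filt (m + wt)" if "wt * (i + k) + j \<le> m" for i j k
    using mono_filt[of "Suc i" k j "m + wt"] that by (simp add: mult.assoc)
qed

text \<open>The relations solved for \<open>d H\<close>, \<open>H u\<close> and \<open>d u\<close>,
  the words that are out of order with respect to \<open>u^i H^j d^k\<close>.\<close>

lemma relations:
  "d * H - (scalar r * (H * d) - scalar \<gamma> * d) \<in> I"
  "H * u - (scalar r * (u * H) - scalar \<gamma> * u) \<in> I"
  "d * u - (scalar s * (u * d) - poly_at g H) \<in> I"
  using relation_ideal_superset[of "down_up_rels g r s \<gamma>"]
  by (auto simp: down_up_rels_def algebra_simps)

lemma filt_rewrite:
  assumes "a - b \<in> I" and "b * p \<in> filt m"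
  shows "a * p \<in> filt m"
  using filt_cong[OF assms(2), of "a * p"] relation_ideal_mult_right[OF assms(1), of p]
  by (simp add: left_diff_distrib)

text \<open>\<open>H\<close> moves past one \<open>u\<close> at a time. Both resulting terms start
  with \<open>u\<close>: the first is covered by the induction hypothesis and \<open>u_filt\<close>,
  the second is itself a monomial.\<close>

lemma H_mono_filt: "H * (u ^ i * (H ^ j * d ^ k)) \<in> filt (wt * (i + k) + j + 1)"
proof (induction i)
  case 0
  show ?case using mono_filt[of 0 k "Suc j"] by (simp add: mult.assoc)
next
  case (Suc i)
  let ?p = "u ^ i * (H ^ j * d ^ k)"
  have "u * (H * ?p) \<in> filt (wt * (Suc i + k) + j + 1)"
    using u_filt[OF Suc.IH] by (simp add: algebra_simps)
  moreover have "u * ?p \<in> filt (wt * (Suc i + k) + j + 1)"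
    using mono_filt[of "Suc i" k j] by (simp add: mult.assoc)
  ultimately have "(scalar r * (u * H) - scalar \<gamma> * u) * ?p \<in> filt (wt * (Suc i + k) + j + 1)"
    by (simp add: left_diff_distrib mult.assoc filt_diff filt_scale)
  from filt_rewrite[OF relations(2) this] show ?case by (simp add: mult.assoc)
qed

lemma H_filt: "p \<in> filt m \<Longrightarrow> H * p \<in> filt (m + 1)"
  by (rule filt_mult_left) (auto intro: filt_mono[OF _ H_mono_filt])

lemma H_power_filt: "p \<in> filt m \<Longrightarrow> H ^ n * p \<in> filt (m + n)"
  by (induction n) (use H_filt in \<open>auto simp: mult.assoc\<close>)

text \<open>Powers of \<open>H\<close> in \<open>g(H)\<close> raise the weight by at most
  \<open>degree g\<close>, which is below \<open>wt\<close>.\<close>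

lemma g_filt: "p \<in> filt m \<Longrightarrow> poly_at g H * p \<in> filt (m + wt)"
  unfolding poly_at_def sum_distrib_right mult.assoc
  by (intro filt_sum filt_scale filt_mono[OF _ H_power_filt]) (auto simp: wt_def)

lemma d_H_power_filt: "d * (H ^ j * d ^ k) \<in> filt (wt * Suc k + j)"
proof (induction j)
  case 0
  show ?case using mono_filt[of 0 "Suc k" 0] by simp
next
  case (Suc j)
  let ?p = "H ^ j * d ^ k"
  have "H * (d * ?p) \<in> filt (wt * Suc k + Suc j)"
    using H_filt[OF Suc.IH] by simp
  moreover have "d * ?p \<in> filt (wt * Suc k + Suc j)"
    by (rule filt_mono[OF _ Suc.IH]) simp
  ultimately have "(scalar r * (H * d) - scalar \<gamma> * d) * ?p \<in> filt (wt * Suc k + Suc j)"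
    by (simp add: left_diff_distrib mult.assoc filt_diff filt_scale)
  from filt_rewrite[OF relations(1) this] show ?case by (simp add: mult.assoc)
qed

lemma d_mono_filt: "d * (u ^ i * (H ^ j * d ^ k)) \<in> filt (wt * (i + k) + j + wt)"
proof (induction i)
  case 0
  show ?case using d_H_power_filt[of j k] by (simp add: algebra_simps)
next
  case (Suc i)
  let ?p = "u ^ i * (H ^ j * d ^ k)"
  have "u * (d * ?p) \<in> filt (wt * (Suc i + k) + j + wt)"
    using u_filt[OF Suc.IH] by (simp add: algebra_simps)
  \<comment> \<open>Replacing \<open>d u\<close> by \<open>g(H)\<close> removes weight
    \<open>2 * wt\<close> and adds at most \<open>wt\<close>.\<close>
  moreover have "poly_at g H * ?p \<in> filt (wt * (Suc i + k) + j + wt)"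
    by (rule filt_mono[OF _ g_filt[OF mono_filt[OF order_refl]]]) simp
  ultimately have "(scalar s * (u * d) - poly_at g H) * ?p \<in> filt (wt * (Suc i + k) + j + wt)"
    by (simp add: left_diff_distrib mult.assoc filt_diff filt_scale)
  from filt_rewrite[OF relations(3) this] show ?case by (simp add: mult.assoc)
qed

lemma d_filt: "p \<in> filt m \<Longrightarrow> d * p \<in> filt (m + wt)"
  by (rule filt_mult_left) (auto intro: filt_mono[OF _ d_mono_filt])

text \<open>Elements that shift the filtration by a bounded amount form a subalgebra: under sums the
  larger shift works, under products shifts add. A shift uniform in \<open>m\<close> can be iterated
  along a word.\<close>

lemma mult_filt: "\<exists>c. \<forall>m. \<forall>p\<in>filt m. q * p \<in> filt (m + c)"
proof (induction q rule: free_alg_induct)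
  case (scalar c)
  show ?case by (rule exI[of _ 0]) (simp add: filt_scale)
next
  case (gen a)
  have "gen a * p \<in> filt (m + wt)" if "p \<in> filt m" for p m
  proof (cases a)
    case GH
    show ?thesis
      unfolding GH by (rule filt_mono[OF _ H_filt[OF that]]) (simp add: wt_def)
  qed (use that u_filt d_filt in auto)
  then show ?case by blast
next
  case (add q q')
  then obtain c c' where c: "\<And>m p. p \<in> filt m \<Longrightarrow> q * p \<in> filt (m + c)"
    and c': "\<And>m p. p \<in> filt m \<Longrightarrow> q' * p \<in> filt (m + c')" by blast
  have "(q + q') * p \<in> filt (m + max c c')" if "p \<in> filt m" for p m
    using filt_mono[OF _ c[OF that], of "m + max c c'"] filt_mono[OF _ c'[OF that], of "m + max c c'"]
    by (simp add: distrib_right filt_add)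
  then show ?case by blast
next
  case (mult q q')
  then obtain c c' where c: "\<And>m p. p \<in> filt m \<Longrightarrow> q * p \<in> filt (m + c)"
    and c': "\<And>m p. p \<in> filt m \<Longrightarrow> q' * p \<in> filt (m + c')" by blast
  have "q * q' * p \<in> filt (m + (c' + c))" if "p \<in> filt m" for p m
    using c[OF c'[OF that]] by (simp add: mult.assoc add.assoc)
  then show ?case by blast
qed

text \<open>Each bit costs at most the shifts of \<open>x\<close> and \<open>h\<close> together,
  whatever these elements are.\<close>

lemma code_word_filt: "\<exists>c. \<forall>bs. code_word x h bs \<in> filt (c * length bs)"
proof -
  obtain c c' where c: "\<And>m p. p \<in> filt m \<Longrightarrow> x * p \<in> filt (m + c)"
    and c': "\<And>m p. p \<in> filt m \<Longrightarrow> h * p \<in> filt (m + c')"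
    using mult_filt[of x] mult_filt[of h] by blast
  have "code_word x h bs \<in> filt ((c + c') * length bs)" for bs
  proof (induction bs)
    case Nil
    show ?case using mono_filt[of 0 0 0 0] by simp
  next
    case (Cons b bs)
    have *: "x * code_word x h bs \<in> filt ((c + c') * length bs + c)" by (rule c[OF Cons.IH])
    show ?case
      using c'[OF *] filt_mono[OF _ *, of "(c + c') * length (b # bs)"]
      by (auto simp: algebra_simps)
  qed
  then show ?thesis by blast
qed

section \<open>Counting the spanning monomials\<close>

lemma exps_subset: "exps m \<subseteq> {..m} \<times> {..m} \<times> {..m}"
proof
  fix x assume "x \<in> exps m"
  then obtain i j k where x: "x = (i, j, k)" and "wt * (i + k) + j \<le> m"
    by (auto simp: exps_def)
  \<comment> \<open>Since \<open>wt\<close> is at least 1, the weight bounds each exponent.\<close>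
  moreover have "i + k + j \<le> wt * (i + k) + j" by (simp add: wt_def)
  ultimately have "i \<le> m" "j \<le> m" "k \<le> m" by linarith+
  then show "x \<in> {..m} \<times> {..m} \<times> {..m}" by (simp add: x)
qed

lemma finite_exps: "finite (exps m)"
  by (rule finite_subset[OF exps_subset]) simp

lemma card_exps: "card (exps m) \<le> (m + 1) ^ 3"
proof -
  have "card (exps m) \<le> card ({..m} \<times> {..m} \<times> {..m})"
    by (rule card_mono[OF _ exps_subset]) simp
  then show ?thesis by (simp add: power3_eq_cube algebra_simps)
qed

end

lemma cubic_less_power_2: "\<exists>n::nat. (c * n + 1) ^ 3 + 1 < 2 ^ n"
proof -
  have "eventually (\<lambda>n::nat. (C * real n + 1) ^ 3 + 1 < 2 ^ n) at_top" if "C > 0" for C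
    using that by real_asymp
  \<comment> \<open>\<open>Suc c\<close> in place of \<open>c\<close> keeps the constant positive,
    as the asymptotic estimate assumes.\<close>
  from this[of "real (Suc c)"]
  obtain n :: nat where "(real (Suc c) * real n + 1) ^ 3 + 1 < 2 ^ n"
    by (auto simp: eventually_at_top_linorder)
  moreover have "(real c * real n + 1) ^ 3 \<le> (real (Suc c) * real n + 1) ^ 3"
    by (intro power_mono add_mono mult_right_mono) auto
  ultimately have "real ((c * n + 1) ^ 3 + 1) < real (2 ^ n)"
    by (simp only: of_nat_add of_nat_mult of_nat_power of_nat_1 of_nat_numeral)
  then show ?thesis unfolding of_nat_less_iff ..
qed

lemma not_isomorphic_down_up:
  assumes deg: "Polynomial.degree f \<ge> 2"
  shows "\<not> generalized_heisenberg f \<cong>\<^sub>a\<^sub>l\<^sub>g generalized_down_up g r s \<gamma>"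
proof
  interpret down_up g r s \<gamma> .
  let ?J = "relation_ideal (heisenberg_rels f)"
  assume "generalized_heisenberg f \<cong>\<^sub>a\<^sub>l\<^sub>g generalized_down_up g r s \<gamma>"
  then obtain \<theta> where
    add: "\<And>p q. \<theta> (p + q) - (\<theta> p + \<theta> q) \<in> ?J" and
    mult: "\<And>p q. \<theta> (p * q) - \<theta> p * \<theta> q \<in> ?J" and
    smult: "\<And>c p. \<theta> (scalar c * p) - scalar c * \<theta> p \<in> ?J" and
    one: "\<theta> 1 - 1 \<in> ?J" and
    ideal: "\<And>p. p \<in> I \<Longrightarrow> \<theta> p \<in> ?J" and
    surj: "\<And>q. \<exists>p. \<theta> p - q \<in> ?J"
    unfolding generalized_heisenberg_conv generalized_down_up_conv
    by (rule presented_algebra_isomorphic_lifting) (rule that)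
  \<comment> \<open>\<open>L\<close> is the action of the down-up algebra on the Verma-type module
    through the inverse isomorphism; applying \<open>verma.lift\<close> turns the congruences for
    \<open>\<theta>\<close> into equations.\<close>
  define L where "L p = verma.lift f (\<theta> p)" for p
  have cong: "verma.lift f p = verma.lift f q" if "p - q \<in> ?J" for p q
    using verma_relation_ideal[OF _ that] by (simp add: verma.lift_diff)
  have L_add: "L (p + q) = L p + L q" for p q
    unfolding L_def using cong[OF add] by (simp add: verma.lift_add)
  have L_mult: "L (p * q) = L p * L q" for p q
    unfolding L_def using cong[OF mult] by (simp add: verma.lift_mult)
  have L_smult: "L (scalar c * p) = verma_scalar c * L p" for c p
    unfolding L_def using cong[OF smult] by (simp add: verma.lift_mult verma.lift_scalar)
  have L_one: "L 1 = 1"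
    unfolding L_def using cong[OF one] by (simp add: verma.lift_1)
  have L_ideal: "L p = 0" if "p \<in> I" for p
    unfolding L_def by (rule verma_relation_ideal[OF _ ideal[OF that]])
  \<comment> \<open>Nothing further is known about the preimages of \<open>x\<close> and
    \<open>h\<close>, which is why \<open>code_word_filt\<close> covers arbitrary elements.\<close>
  obtain X where X: "L X = verma_x"
    using surj[of "gen Gx"] cong by (metis L_def verma.lift_gen verma_gen.simps(1))
  obtain Y where Y: "L Y = verma_h f"
    using surj[of "gen Gh"] cong by (metis L_def verma.lift_gen verma_gen.simps(3))
  have L_code: "L (code_word X Y bs) = verma.lift f (code_word (gen Gx) (gen Gh) bs)" for bs
    by (induction bs) (simp_all add: L_one L_mult X Y verma.lift_mult verma.lift_1 verma.lift_gen)
  obtain c where c: "\<And>bs. code_word X Y bs \<in> filt (c * length bs)"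
    using code_word_filt[of X Y] by blast
  obtain n where n: "(c * n + 1) ^ 3 + 1 < (2::nat) ^ n"
    using cubic_less_power_2[of c] by blast
  \<comment> \<open>Acts on the generator of component 0 and reads component \<open>n\<close>, the
    only one that a code word of length \<open>n\<close> reaches.\<close>
  define T where "T p = endo_apply (L p) (\<lambda>k. if k = 0 then 1 else 0) n" for p
  interpret T: Vector_Spaces.linear "\<lambda>c p. scalar c * p" Polynomial.smult T
    by unfold_locales (simp_all add: T_def L_add L_smult endo_apply_simps verma_apply)
  have T_code: "T (code_word X Y bs) = code_poly f bs" if "length bs = n" for bs
    using that by (simp add: T_def L_code verma_code_word)
  define C where "C = {bs :: bool list. length bs = n}"
  define S where "S = code_poly f ` C"
  \<comment> \<open>\<open>T\<close> sends the whole ideal to 0, so adjoining 0 accounts for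
    \<open>I\<close>; this is the source of the last summand 1 in the bound for
    \<open>n\<close>.\<close>
  define B where "B = insert 0 (T ` mono ` exps (c * n))"
  have span: "S \<subseteq> poly_vs.span B"
  proof
    fix p assume "p \<in> S"
    then obtain bs where bs: "length bs = n" and p: "p = T (code_word X Y bs)"
      by (auto simp: S_def C_def T_code)
    have "p \<in> poly_vs.span (T ` (mono ` exps (c * n) \<union> I))"
      using c[of bs] unfolding p bs filt_def T.span_image by blast
    moreover have "T ` (mono ` exps (c * n) \<union> I) \<subseteq> B"
      by (auto simp: B_def T_def L_ideal endo_apply_simps)
    ultimately show "p \<in> poly_vs.span B" using poly_vs.span_mono by blast
  qed
  have B: "finite B" by (simp add: B_def finite_exps)
  have deg_code: "Polynomial.degree (code_poly f bs) = code_degree (Polynomial.degree f) bs"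
    and code_nz: "code_poly f bs \<noteq> 0" for bs
    using code_poly_degree[of f bs] deg by auto
  have inj: "inj_on (Polynomial.degree \<circ> code_poly f) C"
    using inj_on_code_degree[OF deg, of n] by (simp add: C_def inj_on_def deg_code)
  have C: "card C = 2 ^ n" "finite C"
    using card_lists_length_eq[of "UNIV :: bool set" n] finite_lists_length_eq[of "UNIV :: bool set" n]
    by (simp_all add: C_def)
  have indep: "\<not> poly_vs.dependent S"
  proof (rule independent_distinct_degrees)
    show "finite S" by (simp add: S_def C)
    show "inj_on Polynomial.degree S" unfolding S_def by (rule inj_on_imageI[OF inj])
    show "0 \<notin> S" by (auto simp: S_def code_nz)
  qed
  have "card S \<le> card B"
    using poly_vs.independent_span_bound[OF B indep span] by blast
  also have "\<dots> \<le> Suc (card (T ` mono ` exps (c * n)))"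
    unfolding B_def by (rule card_insert_le_m1) simp_all
  also have "card (T ` mono ` exps (c * n)) \<le> (c * n + 1) ^ 3"
    using card_image_le[of "exps (c * n)" "T \<circ> mono"] card_exps[of "c * n"]
    by (simp add: image_comp finite_exps)
  finally have "card S \<le> (c * n + 1) ^ 3 + 1" by simp
  moreover have "card S = 2 ^ n"
    unfolding S_def using card_image[OF inj_on_imageI2[OF inj]] C by simp
  ultimately show False using n by simp
qed

theorem corollary2p7:
  fixes f :: "complex poly"
  shows "(\<exists>g r s \<gamma>. generalized_heisenberg f \<cong>\<^sub>a\<^sub>l\<^sub>g generalized_down_up g r s \<gamma>)
           \<longleftrightarrow> Polynomial.degree f \<le> 1"
  using heisenberg_isomorphic_down_up[of f] not_isomorphic_down_up[of f]
  by (cases "Polynomial.degree f \<le> 1") auto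

end
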